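(* Let $\mathbf{Y}\sim\mathcal{SUT}_{d,m}(\boldsymbol{\xi},\boldsymbol{\Omega},\boldsymbol{\Delta},\boldsymbol{\tau},\bar{\boldsymbol{\Gamma}},\nu)$ and let $Q_{\mathbf{Y}}=(\mathbf{Y}-\boldsymbol{\xi})^\top\boldsymbol{\Omega}^{-1}(\mathbf{Y}-\boldsymbol{\xi})$. Let $\boldsymbol{\Lambda}=\boldsymbol{\Delta}^\top\bar{\boldsymbol{\Omega}}^{-1}$ and let $(\mathbf{U}_0^{*\top},\mathbf{U}_1^\top)^\top\sim\mathcal{T}_{m+d}\left(\mathbf{0},\begin{pmatrix}\bar{\boldsymbol{\Gamma}}-\boldsymbol{\Delta}^\top\bar{\boldsymbol{\Omega}}^{-1}\boldsymbol{\Delta}&\mathbf{0}\\ \mathbf{0}&\bar{\boldsymbol{\Omega}}\end{pmatrix},\nu\right)$ with $\mathbf{U}_0^*\in\mathbb{R}^m$, $\mathbf{U}_1\in\mathbb{R}^d$, and let $Q_{\mathbf{U}_1}=\mathbf{U}_1^\top\bar{\boldsymbol{\Omega}}^{-1}\mathbf{U}_1$ with density $f_{Q_{\mathbf{U}_1}}$. Then $Q_{\mathbf{Y}}$ has density $$f_{Q_{\mathbf{Y}}}(v)=f_{Q_{\mathbf{U}_1}}(v)\,\frac{\mathrm{P}(\mathbf{U}_0^*<\boldsymbol{\Lambda}\mathbf{U}_1+\boldsymbol{\tau}\mid Q_{\mathbf{U}_1}=v)}{\mathrm{P}(\mathbf{U}_0^*<\boldsymbol{\Lambda}\mathbf{U}_1+\boldsymbol{\tau})},\qquad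 v>0,$$ where inequalities between vectors are componentwise.
   Context: Notation: $\mathcal{T}_k(\boldsymbol{\mu},\boldsymbol{\Sigma},\nu)$ is the $k$-dimensional Student $t$ distribution with location $\boldsymbol{\mu}$, dispersion $\boldsymbol{\Sigma}$ and $\nu>0$ degrees of freedom. Parameters: $\boldsymbol{\xi}\in\mathbb{R}^d$; $\boldsymbol{\Omega}$ a $d\times d$ positive definite matrix, $\boldsymbol{\omega}=\mathrm{diag}(\boldsymbol{\Omega})^{1/2}$, $\bar{\boldsymbol{\Omega}}=\boldsymbol{\omega}^{-1}\boldsymbol{\Omega}\boldsymbol{\omega}^{-1}$; $\boldsymbol{\Delta}$ a $d\times m$ matrix; $\bar{\boldsymbol{\Gamma}}$ an $m\times m$ correlation matrix; $\boldsymbol{\tau}\in\mathbb{R}^m$; $\nu>0$; with $\bar{\boldsymbol{\Omega}}^*=\begin{pmatrix}\bar{\boldsymbol{\Gamma}}&\boldsymbol{\Delta}^\top\\ \boldsymbol{\Delta}&\bar{\boldsymbol{\Omega}}\end{pmatrix}$ positive definite. Definition: if $(\mathbf{U}_0^\top,\mathbf{U}_1^\top)^\top\sim\mathcal{T}_{m+d}(\mathbf{0},\bar{\boldsymbol{\Omega}}^*,\nu)$ ($\mathbf{U}_0\in\mathbb{R}^m$, $\mathbf{U}_1\in\mathbb{R}^d$) and $\mathbf{Z}$ has the conditional distribution of $\mathbf{U}_1$ given $\mathbf{U}_0+\boldsymbol{\tau}>\mathbf{0}$ (componentwise), then $\mathbf{Y}=\boldsymbol{\xi}+\boldsymbol{\omega}\mathbf{Z}$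 has distribution $\mathcal{SUT}_{d,m}(\boldsymbol{\xi},\boldsymbol{\Omega},\boldsymbol{\Delta},\boldsymbol{\tau},\bar{\boldsymbol{\Gamma}},\nu)$. *)

theory Defs
  imports "HOL-Probability.Probability"
begin

text \<open>Positive (semi)definite matrices and correlation matrices.\<close>

definition sym_mat :: "real^'n^'n \<Rightarrow> bool" where
  "sym_mat A \<longleftrightarrow> transpose A = A"

definition pos_def_mat :: "real^'n^'n \<Rightarrow> bool" where
  "pos_def_mat A \<longleftrightarrow> sym_mat A \<and> (\<forall>x. x \<noteq> 0 \<longrightarrow> x \<bullet> (A *v x) > 0)"

definition corr_mat :: "real^'n^'n \<Rightarrow> bool" where
  "corr_mat A \<longleftrightarrow> sym_mat A \<and> (\<forall>x. x \<bullet> (A *v x) \<ge> 0) \<and> (\<forall>i. A $ i $ i = 1)"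

text \<open>omega = diag(Omega)^(1/2) and Omega-bar = omega^-1 Omega omega^-1.\<close>

definition scale_mat :: "real^'n^'n \<Rightarrow> real^'n^'n" where
  "scale_mat \<Omega> = (\<chi> i j. if i = j then sqrt (\<Omega> $ i $ i) else 0)"

definition corr_of :: "real^'n^'n \<Rightarrow> real^'n^'n" where
  "corr_of \<Omega> = (\<chi> i j. \<Omega> $ i $ j / (sqrt (\<Omega> $ i $ i) * sqrt (\<Omega> $ j $ j)))"

text \<open>Block matrix [[G, D^T],[D, O]] indexed by 'm + 'd, and stacking of vectors.\<close>

definition block_mat :: "real^'m::finite^'m \<Rightarrow> real^'m^'d::finite \<Rightarrow> real^'d^'d \<Rightarrow> real^('m + 'd)^('m + 'd)" where
  "block_mat G D Om = (\<chi> k l. case k of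
      Inl i \<Rightarrow> (case l of Inl j \<Rightarrow> G $ i $ j | Inr j \<Rightarrow> D $ j $ i)
    | Inr i \<Rightarrow> (case l of Inl j \<Rightarrow> D $ i $ j | Inr j \<Rightarrow> Om $ i $ j))"

definition vjoin :: "real^'m::finite \<Rightarrow> real^'d::finite \<Rightarrow> real^('m + 'd)" where
  "vjoin u0 u1 = (\<chi> k. case k of Inl i \<Rightarrow> u0 $ i | Inr j \<Rightarrow> u1 $ j)"

definition vfst :: "real^('m::finite + 'd::finite) \<Rightarrow> real^'m" where
  "vfst u = (\<chi> i. u $ Inl i)"

definition vsnd :: "real^('m::finite + 'd::finite) \<Rightarrow> real^'d" where
  "vsnd u = (\<chi> j. u $ Inr j)"

text \<open>Multivariate Student t distribution T_k(mu, Sigma, nu), k = CARD('n),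
  given by its Lebesgue density.\<close>

definition mvt_density :: "real^'n \<Rightarrow> real^'n^'n \<Rightarrow> real \<Rightarrow> real^'n \<Rightarrow> real" where
  "mvt_density \<mu> \<Sigma> \<nu> x =
     (let k = real CARD('n) in
      Gamma ((\<nu> + k) / 2) / (Gamma (\<nu> / 2) * (\<nu> * pi) powr (k / 2) * sqrt (det \<Sigma>))
      * (1 + ((x - \<mu>) \<bullet> (matrix_inv \<Sigma> *v (x - \<mu>))) / \<nu>) powr (- (\<nu> + k) / 2))"

definition mvt_measure :: "real^'n \<Rightarrow> real^'n^'n \<Rightarrow> real \<Rightarrow> (real^'n) measure" where
  "mvt_measure \<mu> \<Sigma> \<nu> = density lborel (\<lambda>x. ennreal (mvt_density \<mu> \<Sigma> \<nu> x))"

text \<open>The unified skew-t distribution SUT_{d,m}(xi, Omega, Delta, tau, Gamma, nu):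
  law of Y = xi + omega Z, where Z ~ U1 | U0 + tau > 0 and (U0,U1) ~ T_{m+d}(0, Omega*, nu).\<close>

definition SUT :: "real^'d \<Rightarrow> real^'d^'d \<Rightarrow> real^'m^'d \<Rightarrow> real^'m \<Rightarrow> real^'m^'m \<Rightarrow> real
                   \<Rightarrow> (real^'d) measure" where
  "SUT \<xi> \<Omega> \<Delta> \<tau> \<Gamma> \<nu> =
     (let T = mvt_measure 0 (block_mat \<Gamma> \<Delta> (corr_of \<Omega>)) \<nu>;
          E = {u. \<forall>i. vfst u $ i + \<tau> $ i > 0}
      in distr (uniform_measure T E) borel (\<lambda>u. \<xi> + scale_mat \<Omega> *v vsnd u))"

end

theory Submission
  imports Defs
begin

(*
  Let \<Lambda> = \<Delta>\<^sup>T R\<^sup>-\<^sup>1 with R = corr_of \<Omega>. The shear L = [[-I, \<Lambda>], [0, I]] is an involution, and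
  congruence by L turns the dispersion \<Omega>* of (U0, U1) into diag(\<Gamma> - \<Lambda>\<Delta>, R) (a Schur
  complement). Hence (U0, U1) has the law of (\<Lambda>U1 - U0*, U1), and selecting on U0 + \<tau> > 0 is
  selecting on U0* < \<Lambda>U1 + \<tau>. Since scaling by \<omega> carries the \<Omega>-form of Y - \<xi> to the R-form
  of Z, Q\<^sub>Y has the law of Q\<^sub>U\<^sub>1 conditioned on that event; as c disintegrates the event along
  Q\<^sub>U\<^sub>1, this conditional law has density g c / P(event). Finally Q\<^sub>U\<^sub>1 \<ge> 0 has no atom at 0,
  so g vanishes almost everywhere on v \<le> 0.
*)


section \<open>Matrices\<close>

lemma matrix_inv_inverse:
  fixes A :: "'a::semiring_1^'n^'n"
  assumes "invertible A"
  shows "A ** matrix_inv A = mat 1" and "matrix_inv A ** A = mat 1"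
  using someI_ex[OF assms[unfolded invertible_def]] by (simp_all add: matrix_inv_def)

lemma matrix_inv_eqI:
  fixes A B :: "'a::field^'n^'n"
  assumes "A ** B = mat 1"
  shows "matrix_inv A = B"
proof -
  have "invertible A"
    using assms matrix_left_right_inverse unfolding invertible_def by blast
  then have "matrix_inv A = matrix_inv A ** (A ** B)" using assms by simp
  also have "\<dots> = B"
    using matrix_inv_inverse(2)[OF \<open>invertible A\<close>] by (simp add: matrix_mul_assoc)
  finally show ?thesis .
qed

lemma transpose_matrix_inv_symmetric:
  fixes A :: "'a::field^'n^'n"
  assumes "invertible A" and "transpose A = A"
  shows "transpose (matrix_inv A) = matrix_inv A"
proof -
  have "transpose (matrix_inv A) ** A = mat 1"
    using assms matrix_inv_inverse(1)[OF assms(1)] by (metis matrix_transpose_mul transpose_mat)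
  then show ?thesis
    by (metis matrix_inv_eqI matrix_left_right_inverse)
qed

lemma pos_def_mat_invertible:
  fixes A :: "real^'n^'n"
  assumes "pos_def_mat A"
  shows "invertible A"
proof -
  have "x = 0" if "A *v x = 0" for x
    using assms that unfolding pos_def_mat_def by (metis inner_zero_right less_irrefl)
  then show ?thesis
    using matrix_left_invertible_ker invertible_left_inverse by blast
qed

lemma pos_def_mat_diag_pos:
  assumes "pos_def_mat (A::real^'n^'n)"
  shows "0 < A $ i $ i"
proof -
  have "axis i 1 \<bullet> (A *v axis i (1::real)) = A $ i $ i"
    by (simp add: matrix_vector_mult_basis column_def inner_axis')
  then show ?thesis
    using assms unfolding pos_def_mat_def by (metis axis_eq_0_iff zero_neq_one)
qed

lemma quadratic_form_matrix_inv_nonneg: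
  assumes "pos_def_mat (A::real^'n^'n)"
  shows "0 \<le> x \<bullet> (matrix_inv A *v x)"
proof -
  define y where "y = matrix_inv A *v x"
  have "x = A *v y"
    using matrix_inv_inverse(1)[OF pos_def_mat_invertible[OF assms]]
    by (simp add: y_def matrix_vector_mul_assoc)
  then show ?thesis
    using assms unfolding pos_def_mat_def y_def[symmetric]
    by (cases "y = 0") (auto simp: inner_commute less_imp_le)
qed

lemma inner_transpose_mulv: "(x::real^'n) \<bullet> (transpose A *v y) = (A *v x) \<bullet> y"
  by (metis dot_lmul_matrix inner_commute transpose_matrix_vector transpose_transpose)

lemma matrix_mul_uminus_left [simp]: "(- A) ** (B::'a::ring_1^'n^'k) = - (A ** B)"
  by (simp add: vec_eq_iff matrix_matrix_mult_def sum_negf)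

lemma matrix_mul_uminus_right [simp]: "(A::'a::ring_1^'n^'k) ** (- B) = - (A ** B)"
  by (simp add: vec_eq_iff matrix_matrix_mult_def sum_negf)

lemma matrix_vector_mult_uminus_left [simp]: "(- A) *v (x::'a::ring_1^'n) = - (A *v x)"
  by (simp add: vec_eq_iff matrix_vector_mult_def sum_negf)

lemma transpose_zero [simp]: "transpose 0 = 0"
  by (simp add: vec_eq_iff transpose_def)

lemma transpose_uminus: "transpose (- A) = - transpose A"
  by (simp add: vec_eq_iff transpose_def)

lemma abs_det_involution:
  fixes L :: "real^'n^'n"
  assumes "L ** L = mat 1"
  shows "\<bar>det L\<bar> = 1"
proof -
  have "det L * det L = 1"
    using assms by (metis det_I det_mul)
  then show ?thesis
    by (auto simp: square_eq_1_iff)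
qed

lemma mulv_involution: "L ** L = mat 1 \<Longrightarrow> L *v (L *v x) = x"
  by (simp add: matrix_vector_mul_assoc)

lemma det_involution_congruence:
  fixes L D :: "real^'n^'n"
  assumes "L ** L = mat 1"
  shows "det (L ** D ** transpose L) = det D"
proof -
  have "det L * det L = 1"
    using abs_det_involution[OF assms] abs_mult_self_eq[of "det L"] by simp
  then show ?thesis
    by (simp add: det_mul det_transpose)
qed

lemma matrix_inv_involution_congruence:
  fixes L D :: "real^'n^'n"
  assumes L: "L ** L = mat 1" and D: "invertible D"
  shows "matrix_inv (L ** D ** transpose L) = transpose L ** matrix_inv D ** L"
proof (rule matrix_inv_eqI)
  have "transpose L ** transpose L = mat 1"
    using L by (metis matrix_transpose_mul transpose_mat)
  have "(L ** D ** transpose L) ** (transpose L ** matrix_inv D ** L)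
          = L ** (D ** (transpose L ** transpose L) ** matrix_inv D) ** L"
    by (simp add: matrix_mul_assoc)
  also have "\<dots> = mat 1"
    using L \<open>transpose L ** transpose L = mat 1\<close> matrix_inv_inverse(1)[OF D] by simp
  finally show "(L ** D ** transpose L) ** (transpose L ** matrix_inv D ** L) = mat 1" .
qed

definition diag_mat :: "('n::finite \<Rightarrow> real) \<Rightarrow> real^'n^'n" where
  "diag_mat d = (\<chi> i j. if i = j then d i else 0)"

lemma diag_mat_mult_left: "diag_mat d ** A = (\<chi> i j. d i * A $ i $ j)"
  by (simp add: diag_mat_def matrix_matrix_mult_def vec_eq_iff if_distrib[of "\<lambda>x. x * _"] cong: if_cong)

lemma diag_mat_mult_right: "A ** diag_mat d = (\<chi> i j. A $ i $ j * d j)"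
  by (simp add: diag_mat_def matrix_matrix_mult_def vec_eq_iff if_distrib[of "\<lambda>x. _ * x"] cong: if_cong)

lemma transpose_diag_mat: "transpose (diag_mat d) = diag_mat d"
  by (simp add: diag_mat_def transpose_def vec_eq_iff)

lemma scale_mat_eq_diag_mat: "scale_mat \<Omega> = diag_mat (\<lambda>i. sqrt (\<Omega> $ i $ i))"
  by (simp add: scale_mat_def diag_mat_def)

lemma matrix_inv_corr_of:
  fixes \<Omega> :: "real^'n::finite^'n"
  assumes "pos_def_mat \<Omega>"
  shows "matrix_inv (corr_of \<Omega>) = scale_mat \<Omega> ** matrix_inv \<Omega> ** scale_mat \<Omega>"
proof -
  define s where "s i = sqrt (\<Omega> $ i $ i)" for i
  have "s i \<noteq> 0" for i
    unfolding s_def using pos_def_mat_diag_pos[OF assms, of i] by simp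
  then have inv_s: "diag_mat (\<lambda>i. 1 / s i) ** diag_mat s = mat 1"
    by (simp add: diag_mat_mult_left vec_eq_iff mat_def) (simp add: diag_mat_def)
  have "corr_of \<Omega> = diag_mat (\<lambda>i. 1 / s i) ** \<Omega> ** diag_mat (\<lambda>i. 1 / s i)"
    by (simp add: diag_mat_mult_left diag_mat_mult_right corr_of_def s_def vec_eq_iff)
  then have "corr_of \<Omega> ** (diag_mat s ** matrix_inv \<Omega> ** diag_mat s)
      = diag_mat (\<lambda>i. 1 / s i) ** \<Omega> ** (diag_mat (\<lambda>i. 1 / s i) ** diag_mat s) ** matrix_inv \<Omega> ** diag_mat s"
    by (simp add: matrix_mul_assoc)
  also have "\<dots> = diag_mat (\<lambda>i. 1 / s i) ** (\<Omega> ** matrix_inv \<Omega>) ** diag_mat s"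
    by (simp add: inv_s matrix_mul_assoc)
  also have "\<dots> = mat 1"
    using inv_s matrix_inv_inverse(1)[OF pos_def_mat_invertible[OF assms]] by simp
  finally show ?thesis
    unfolding scale_mat_eq_diag_mat s_def[symmetric] by (rule matrix_inv_eqI)
qed

lemma quadratic_form_scale_mat:
  fixes \<Omega> :: "real^'n::finite^'n"
  assumes "pos_def_mat \<Omega>"
  shows "(scale_mat \<Omega> *v z) \<bullet> (matrix_inv \<Omega> *v (scale_mat \<Omega> *v z)) = z \<bullet> (matrix_inv (corr_of \<Omega>) *v z)"
  using inner_transpose_mulv[of z "scale_mat \<Omega>"]
  by (simp add: matrix_inv_corr_of[OF assms] scale_mat_eq_diag_mat transpose_diag_mat
      flip: matrix_vector_mul_assoc)

section \<open>Block matrices\<close>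

definition block_matrix ::
    "'a^'m::finite^'m \<Rightarrow> 'a^'d::finite^'m \<Rightarrow> 'a^'m^'d \<Rightarrow> 'a^'d^'d \<Rightarrow> 'a^('m + 'd)^('m + 'd)"
  where "block_matrix A B C D = (\<chi> k l. case k of
      Inl i \<Rightarrow> (case l of Inl j \<Rightarrow> A $ i $ j | Inr j \<Rightarrow> B $ i $ j)
    | Inr i \<Rightarrow> (case l of Inl j \<Rightarrow> C $ i $ j | Inr j \<Rightarrow> D $ i $ j))"

lemma block_matrix_nth [simp]:
  "block_matrix A B C D $ Inl i $ Inl j = A $ i $ j"
  "block_matrix A B C D $ Inl i $ Inr j' = B $ i $ j'"
  "block_matrix A B C D $ Inr i' $ Inl j = C $ i' $ j"
  "block_matrix A B C D $ Inr i' $ Inr j' = D $ i' $ j'"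
  by (simp_all add: block_matrix_def)

lemma eq_block_matrix_iff:
  "X = block_matrix A B C D \<longleftrightarrow>
     (\<forall>i j. X $ Inl i $ Inl j = A $ i $ j) \<and> (\<forall>i j. X $ Inl i $ Inr j = B $ i $ j) \<and>
     (\<forall>i j. X $ Inr i $ Inl j = C $ i $ j) \<and> (\<forall>i j. X $ Inr i $ Inr j = D $ i $ j)"
  apply (auto simp: vec_eq_iff)
  subgoal for k l by (cases k; cases l; simp)
  done

lemma sum_UNIV_sum_type:
  "(\<Sum>k\<in>(UNIV::('a::finite + 'b::finite) set). f k) = (\<Sum>i\<in>UNIV. f (Inl i)) + (\<Sum>j\<in>UNIV. f (Inr j))"
proof -
  have "(\<Sum>k\<in>(UNIV::('a + 'b) set). f k) = (\<Sum>k\<in>(UNIV <+> UNIV). f k)" by simp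
  also have "\<dots> = (\<Sum>i\<in>UNIV. f (Inl i)) + (\<Sum>j\<in>UNIV. f (Inr j))"
    by (subst sum.Plus) (auto simp: comp_def)
  finally show ?thesis .
qed

lemma block_mat_eq_block_matrix: "block_mat G D Om = block_matrix G (transpose D) D Om"
  by (simp add: eq_block_matrix_iff block_mat_def transpose_def)

lemma block_matrix_mult:
  "block_matrix A B C D ** block_matrix A' B' C' D' =
     block_matrix (A ** A' + B ** C') (A ** B' + B ** D') (C ** A' + D ** C') (C ** B' + D ** D')"
  by (simp add: eq_block_matrix_iff matrix_matrix_mult_def sum_UNIV_sum_type)

lemma transpose_block_matrix:
  "transpose (block_matrix A B C D) = block_matrix (transpose A) (transpose C) (transpose B) (transpose D)"
  by (simp add: eq_block_matrix_iff transpose_def)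

lemma mat_1_eq_block_matrix: "mat 1 = block_matrix (mat 1) 0 0 (mat 1)"
  by (simp add: eq_block_matrix_iff mat_def)

lemma vjoin_nth [simp]: "vjoin x y $ Inl i = x $ i" "vjoin x y $ Inr j = y $ j"
  by (simp_all add: vjoin_def)

lemma vfst_vjoin [simp]: "vfst (vjoin x y) = x" and vsnd_vjoin [simp]: "vsnd (vjoin x y) = y"
  by (simp_all add: vfst_def vsnd_def)

lemma vjoin_eq_0_iff [simp]: "vjoin x y = 0 \<longleftrightarrow> x = 0 \<and> y = 0"
proof
  show "x = 0 \<and> y = 0" if "vjoin x y = 0"
    using vjoin_nth[of x y] that by (simp add: vec_eq_iff)
  show "vjoin x y = 0" if "x = 0 \<and> y = 0"
    using that by (simp add: vec_eq_iff vjoin_def split: sum.split)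
qed

lemma inner_vjoin: "vjoin x y \<bullet> vjoin x' y' = x \<bullet> x' + y \<bullet> y'"
  by (simp add: inner_vec_def sum_UNIV_sum_type)

lemma block_matrix_mulv_vjoin:
  "block_matrix A B C D *v vjoin x y = vjoin (A *v x + B *v y) (C *v x + D *v y)"
  unfolding vec_eq_iff
proof
  fix k show "(block_matrix A B C D *v vjoin x y) $ k = vjoin (A *v x + B *v y) (C *v x + D *v y) $ k"
    by (cases k) (simp_all add: matrix_vector_mult_def sum_UNIV_sum_type)
qed

lemma pos_def_mat_block_mat_lower:
  fixes Om :: "real^'d::finite^'d"
  assumes "pos_def_mat (block_mat G D Om)"
  shows "pos_def_mat Om"
  unfolding pos_def_mat_def
proof
  have "transpose (block_mat G D Om) = block_mat G D Om"
    using assms unfolding pos_def_mat_def sym_mat_def by blast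
  then show "sym_mat Om"
    unfolding block_mat_eq_block_matrix transpose_block_matrix eq_block_matrix_iff sym_mat_def
    by (simp add: vec_eq_iff transpose_def)
  show "\<forall>z. z \<noteq> 0 \<longrightarrow> z \<bullet> (Om *v z) > 0"
  proof (intro allI impI)
    fix z :: "real^'d" assume "z \<noteq> 0"
    then have "vjoin 0 z \<bullet> (block_mat G D Om *v vjoin 0 z) > 0"
      using assms unfolding pos_def_mat_def by simp
    then show "z \<bullet> (Om *v z) > 0"
      by (simp add: block_mat_eq_block_matrix block_matrix_mulv_vjoin inner_vjoin)
  qed
qed

definition shear_mat :: "real^'d::finite^'m::finite \<Rightarrow> real^('m + 'd)^('m + 'd)" where
  "shear_mat \<Lambda> = block_matrix (- mat 1) \<Lambda> 0 (mat 1)"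

lemma shear_mat_involution: "shear_mat \<Lambda> ** shear_mat \<Lambda> = mat 1"
  by (simp add: shear_mat_def block_matrix_mult mat_1_eq_block_matrix)

lemma shear_mat_mulv_vjoin: "shear_mat \<Lambda> *v vjoin x y = vjoin (\<Lambda> *v y - x) y"
  by (simp add: shear_mat_def block_matrix_mulv_vjoin)

lemma block_mat_eq_shear_congruence:
  fixes G :: "real^'m::finite^'m" and D :: "real^'m^'d::finite" and Om :: "real^'d^'d"
  assumes "invertible Om" and "transpose Om = Om"
  defines "\<Lambda> \<equiv> transpose D ** matrix_inv Om"
  shows "block_mat G D Om =
           shear_mat \<Lambda> ** block_mat (G - \<Lambda> ** D) 0 Om ** transpose (shear_mat \<Lambda>)"
proof -
  have \<Lambda>_Om: "\<Lambda> ** Om = transpose D"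
    using matrix_inv_inverse(2)[OF assms(1)] by (simp add: \<Lambda>_def flip: matrix_mul_assoc)
  then have Om_\<Lambda>: "Om ** transpose \<Lambda> = D"
    using assms(2) by (metis matrix_transpose_mul transpose_transpose)
  have "transpose D ** transpose \<Lambda> = \<Lambda> ** D"
    using transpose_matrix_inv_symmetric[OF assms(1,2)]
    by (simp add: \<Lambda>_def matrix_transpose_mul matrix_mul_assoc)
  moreover have "\<Lambda> ** Om ** transpose \<Lambda> = \<Lambda> ** D"
    using Om_\<Lambda> by (simp flip: matrix_mul_assoc)
  ultimately show ?thesis
    unfolding shear_mat_def block_mat_eq_block_matrix block_matrix_mult transpose_block_matrix
    by (simp add: \<Lambda>_Om Om_\<Lambda> transpose_uminus matrix_mul_assoc)
qed

section \<open>Measurability\<close>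

lemma mulv_borel_measurable [measurable]: "(\<lambda>x. (A::real^'n^'m) *v x) \<in> borel_measurable borel"
  by (intro borel_measurable_continuous_onI linear_continuous_on)
     (simp add: linear_conv_bounded_linear matrix_vector_mul_linear)

lemma borel_measurable_vec_lambda [measurable]:
  assumes "\<And>i. (\<lambda>x. f x i) \<in> borel_measurable M"
  shows "(\<lambda>x. \<chi> i. f x i :: real^'n) \<in> borel_measurable M"
  using assms by (subst borel_measurable_euclidean_space) (auto simp: Basis_vec_def inner_axis)

lemma borel_measurable_vec_nth [measurable (raw)]:
  "f \<in> borel_measurable M \<Longrightarrow> (\<lambda>x. (f x :: real^'n) $ i) \<in> borel_measurable M"
  by (rule measurable_compose[OF _ borel_measurable_nth])

lemma vsnd_borel_measurable [measurable]: "vsnd \<in> borel_measurable borel"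
  unfolding vsnd_def by measurable

lemma vjoin_borel_measurable [measurable]:
  fixes f :: "'a \<Rightarrow> real^'m::finite" and g :: "'a \<Rightarrow> real^'d::finite"
  assumes "f \<in> borel_measurable M" "g \<in> borel_measurable M"
  shows "(\<lambda>x. vjoin (f x) (g x)) \<in> borel_measurable M"
  unfolding vjoin_def
proof (rule borel_measurable_vec_lambda)
  fix k :: "'m + 'd"
  show "(\<lambda>x. case k of Inl i \<Rightarrow> f x $ i | Inr j \<Rightarrow> g x $ j) \<in> borel_measurable M"
    using assms by (cases k) simp_all
qed

lemma mvt_density_borel_measurable [measurable]: "mvt_density \<mu> \<Sigma> \<nu> \<in> borel_measurable borel"
  unfolding mvt_density_def Let_def by measurable

section \<open>Linear images of the multivariate t distribution\<close>

lemma distr_lborel_involution: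
  fixes L :: "real^'n::{finite,wellorder}^'n::{finite,wellorder}"
  assumes L: "L ** L = mat 1"
  shows "distr lborel borel ((*v) L) = lborel"
proof (rule lborel_eqI[symmetric])
  fix l u :: "real^'n::{finite,wellorder}"
  assume le: "\<And>b. b \<in> Basis \<Longrightarrow> l \<bullet> b \<le> u \<bullet> b"
  have lin: "linear ((*v) L)"
    by (simp add: matrix_vector_mul_linear)
  have pre: "(*v) L -` box l u = (*v) L ` box l u"
  proof (intro set_eqI iffI)
    show "x \<in> (*v) L ` box l u" if "x \<in> (*v) L -` box l u" for x
      using that image_eqI[of x "(*v) L" "L *v x"] by (simp add: mulv_involution[OF L])
  qed (auto simp: mulv_involution[OF L])
  have "(*v) L ` box l u \<in> sets lborel"
    using pre measurable_sets_borel[OF mulv_borel_measurable[of L], of "box l u"] by simp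
  then have "emeasure lborel ((*v) L -` box l u) = emeasure lebesgue ((*v) L ` box l u)"
    unfolding pre by simp
  also have "\<dots> = measure lebesgue ((*v) L ` box l u)"
    using measurable_linear_image[OF lin, of "box l u"] by (simp add: emeasure_eq_measure2)
  also have "\<dots> = measure lebesgue (box l u)"
    using measure_linear_image[OF lin, of "box l u"] abs_det_involution[OF L] by simp
  also have "\<dots> = emeasure lborel (box l u)"
    by (simp add: emeasure_eq_measure2 measure_completion)
  finally have "emeasure lborel ((*v) L -` box l u) = emeasure lborel (box l u)" .
  then show "emeasure (distr lborel borel ((*v) L)) (box l u) = (\<Prod>b\<in>Basis. (u - l) \<bullet> b)"
    using le by (simp add: emeasure_distr emeasure_lborel_box_eq)
qed simp

lemma mvt_density_involution:
  fixes L D :: "real^'n^'n"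
  assumes L: "L ** L = mat 1" and D: "invertible D"
  shows "mvt_density 0 D \<nu> (L *v x) = mvt_density 0 (L ** D ** transpose L) \<nu> x"
proof -
  have "matrix_inv (L ** D ** transpose L) *v x = transpose L *v (matrix_inv D *v (L *v x))"
    by (simp only: matrix_inv_involution_congruence[OF L D] flip: matrix_vector_mul_assoc)
  then have "x \<bullet> (matrix_inv (L ** D ** transpose L) *v x) = (L *v x) \<bullet> (matrix_inv D *v (L *v x))"
    by (simp only: inner_transpose_mulv)
  then show ?thesis
    by (simp add: mvt_density_def det_involution_congruence[OF L])
qed

lemma distr_mvt_measure_involution:
  fixes L D :: "real^'n::{finite,wellorder}^'n::{finite,wellorder}"
  assumes L: "L ** L = mat 1" and D: "invertible D"
  shows "distr (mvt_measure 0 D \<nu>) borel ((*v) L) = mvt_measure 0 (L ** D ** transpose L) \<nu>"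
proof -
  have "distr (density (distr lborel borel ((*v) L)) (\<lambda>x. mvt_density 0 D \<nu> x)) lborel ((*v) L)
          = mvt_measure 0 (L ** D ** transpose L) \<nu>"
    unfolding mvt_measure_def
    by (subst distr_density_distr) (auto simp: mulv_involution[OF L] mvt_density_involution[OF L D] comp_def)
  then show ?thesis
    unfolding distr_lborel_involution[OF L] mvt_measure_def by (simp cong: distr_cong)
qed

text \<open>The change of variables theorems for linear maps require a well-ordered index type,
  and the joint vector (U0, U1) is indexed by a sum type.\<close>

instantiation sum :: (finite, finite) wellorder
begin

definition less_eq_sum :: "'a + 'b \<Rightarrow> 'a + 'b \<Rightarrow> bool" where
  "less_eq_sum x y \<longleftrightarrow> to_nat x \<le> to_nat y"

definition less_sum :: "'a + 'b \<Rightarrow> 'a + 'b \<Rightarrow> bool" where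
  "less_sum x y \<longleftrightarrow> to_nat x < to_nat y"

instance
proof
  fix x y z :: "'a + 'b"
  show "x < y \<longleftrightarrow> x \<le> y \<and> \<not> y \<le> x" "x \<le> x" "x \<le> y \<or> y \<le> x"
    unfolding less_eq_sum_def less_sum_def by auto
  show "x \<le> y \<Longrightarrow> y \<le> z \<Longrightarrow> x \<le> z"
    unfolding less_eq_sum_def by auto
  show "x \<le> y \<Longrightarrow> y \<le> x \<Longrightarrow> x = y"
    unfolding less_eq_sum_def by (meson antisym inj_eq inj_to_nat)
next
  fix P :: "'a + 'b \<Rightarrow> bool" and a
  assume "\<And>x. (\<And>y. y < x \<Longrightarrow> P y) \<Longrightarrow> P x"
  then show "P a"
    unfolding less_sum_def by (induct a rule: measure_induct_rule[of to_nat]) blast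
qed

end

lemma mvt_measure_block_mat_shear:
  fixes G :: "real^'m::finite^'m" and D :: "real^'m^'d::finite" and Om :: "real^'d^'d"
  assumes S: "pos_def_mat (block_mat G D Om)"
  defines "\<Lambda> \<equiv> transpose D ** matrix_inv Om"
  shows "mvt_measure 0 (block_mat G D Om) \<nu>
           = distr (mvt_measure 0 (block_mat (G - \<Lambda> ** D) 0 Om) \<nu>) borel ((*v) (shear_mat \<Lambda>))"
proof -
  have "pos_def_mat Om"
    using pos_def_mat_block_mat_lower[OF S] .
  then have congr: "block_mat G D Om = shear_mat \<Lambda> ** block_mat (G - \<Lambda> ** D) 0 Om ** transpose (shear_mat \<Lambda>)"
    unfolding \<Lambda>_def
    by (intro block_mat_eq_shear_congruence pos_def_mat_invertible)
       (auto simp: pos_def_mat_def sym_mat_def)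
  have "det (block_mat G D Om) \<noteq> 0"
    using pos_def_mat_invertible[OF S] by (simp add: invertible_det_nz)
  then have "invertible (block_mat (G - \<Lambda> ** D) 0 Om)"
    unfolding congr det_involution_congruence[OF shear_mat_involution] by (simp add: invertible_det_nz)
  then show ?thesis
    unfolding congr by (rule distr_mvt_measure_involution[OF shear_mat_involution, symmetric])
qed

section \<open>The quadratic form of a SUT vector\<close>

lemma distr_uniform_measure_distr:
  assumes F: "F \<in> measurable N M" and G: "G \<in> measurable M K" and A: "A \<in> sets M"
  shows "distr (uniform_measure (distr N M F) A) K G
           = distr (uniform_measure N (F -` A \<inter> space N)) K (\<lambda>x. G (F x))"
proof (rule measure_eqI)
  have [measurable]: "G \<in> measurable (uniform_measure (distr N M F) A) K"
    using G by (simp cong: measurable_cong_sets)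
  have [measurable]: "(\<lambda>x. G (F x)) \<in> measurable (uniform_measure N (F -` A \<inter> space N)) K"
    using measurable_comp[OF F G] by (simp add: comp_def cong: measurable_cong_sets)
  fix B assume "B \<in> sets (distr (uniform_measure (distr N M F) A) K G)"
  then have [measurable]: "B \<in> sets K" by simp
  have "F -` A \<inter> (F -` G -` B \<inter> F -` space M) \<inter> space N
          = F -` A \<inter> space N \<inter> ((\<lambda>x. G (F x)) -` B \<inter> space N)"
    using measurable_space[OF F] by auto
  then show "emeasure (distr (uniform_measure (distr N M F) A) K G) B
           = emeasure (distr (uniform_measure N (F -` A \<inter> space N)) K (\<lambda>x. G (F x))) B"
    using F G A by (simp add: emeasure_distr measurable_sets)
qed simp

lemma distr_SUT_quadratic_form:
  fixes \<xi> :: "real^'d::finite" and \<Omega> :: "real^'d^'d" and \<Delta> :: "real^'m::finite^'d"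
    and \<tau> :: "real^'m" and \<Gamma> :: "real^'m^'m" and \<nu> :: real
    and U0s :: "'b \<Rightarrow> real^'m" and U1 :: "'b \<Rightarrow> real^'d"
  defines "\<Lambda> \<equiv> transpose \<Delta> ** matrix_inv (corr_of \<Omega>)"
  assumes \<Omega>: "pos_def_mat \<Omega>" and S: "pos_def_mat (block_mat \<Gamma> \<Delta> (corr_of \<Omega>))"
    and [measurable]: "U0s \<in> borel_measurable N" "U1 \<in> borel_measurable N"
    and U_law: "distr N borel (\<lambda>w. vjoin (U0s w) (U1 w))
                  = mvt_measure 0 (block_mat (\<Gamma> - \<Lambda> ** \<Delta>) 0 (corr_of \<Omega>)) \<nu>"
  shows "distr (SUT \<xi> \<Omega> \<Delta> \<tau> \<Gamma> \<nu>) borel (\<lambda>y. (y - \<xi>) \<bullet> (matrix_inv \<Omega> *v (y - \<xi>)))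
           = distr (uniform_measure N {w \<in> space N. \<forall>i. U0s w $ i < (\<Lambda> *v U1 w + \<tau>) $ i})
               borel (\<lambda>w. U1 w \<bullet> (matrix_inv (corr_of \<Omega>) *v U1 w))"
proof -
  define q where "q u = vsnd u \<bullet> (matrix_inv (corr_of \<Omega>) *v vsnd u)" for u :: "real^('m + 'd)"
  define F where "F w = shear_mat \<Lambda> *v vjoin (U0s w) (U1 w)" for w
  define E where "E = {u::real^('m + 'd). \<forall>i. vfst u $ i + \<tau> $ i > 0}"
  have [measurable]: "E \<in> sets borel"
    unfolding E_def vfst_def by measurable
  have [measurable]: "F \<in> borel_measurable N" "q \<in> borel_measurable borel"
    unfolding F_def q_def by measurable
  have T: "mvt_measure 0 (block_mat \<Gamma> \<Delta> (corr_of \<Omega>)) \<nu> = distr N borel F"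
    unfolding mvt_measure_block_mat_shear[OF S] \<Lambda>_def[symmetric] U_law[symmetric] F_def
    by (subst distr_distr) (auto simp: comp_def)
  have "distr (SUT \<xi> \<Omega> \<Delta> \<tau> \<Gamma> \<nu>) borel (\<lambda>y. (y - \<xi>) \<bullet> (matrix_inv \<Omega> *v (y - \<xi>)))
          = distr (uniform_measure (distr N borel F) E) borel q"
    unfolding SUT_def Let_def T E_def[symmetric]
    by (subst distr_distr)
       (auto simp: comp_def q_def[abs_def] quadratic_form_scale_mat[OF \<Omega>] cong: measurable_cong_sets)
  also have "\<dots> = distr (uniform_measure N (F -` E \<inter> space N)) borel (\<lambda>w. q (F w))"
    by (rule distr_uniform_measure_distr) measurable
  also have "F -` E \<inter> space N = {w \<in> space N. \<forall>i. U0s w $ i < (\<Lambda> *v U1 w + \<tau>) $ i}"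
    by (auto simp: F_def E_def shear_mat_mulv_vjoin algebra_simps)
  finally show ?thesis
    by (simp add: q_def F_def shear_mat_mulv_vjoin)
qed

section \<open>Densities from a disintegration\<close>

lemma AE_nonneg_if_set_integral_nonneg:
  fixes f :: "'a \<Rightarrow> real"
  assumes f: "integrable M f" and nonneg: "\<And>A. A \<in> sets M \<Longrightarrow> 0 \<le> (\<integral>x\<in>A. f x \<partial>M)"
  shows "AE x in M. 0 \<le> f x"
proof -
  define A where "A = {x \<in> space M. f x < 0}"
  have A: "A \<in> sets M"
    using borel_measurable_integrable[OF f] unfolding A_def by measurable
  have "set_integrable M A f"
    using integrable_mult_indicator[OF A f] by (simp add: set_integrable_def)
  then have "(\<integral>x\<in>A. f x \<partial>M) \<le> (\<integral>x\<in>A. 0 \<partial>M)"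
    by (rule set_integral_mono) (auto simp: A_def set_integrable_def)
  then have "(\<integral>x\<in>A. - f x \<partial>M) = 0"
    using nonneg[OF A] set_integral_uminus[OF \<open>set_integrable M A f\<close>] by simp
  then have "A \<in> null_sets M"
    using f A by (intro null_if_pos_func_has_zero_int[where f="\<lambda>x. - f x"]) (auto simp: A_def)
  then have "AE x in M. x \<notin> A"
    by (rule AE_not_in)
  then show ?thesis
    using AE_space by eventually_elim (auto simp: A_def)
qed

lemma distributed_nonneg_AE_density_eq_0:
  fixes X :: "'a \<Rightarrow> real"
  assumes X: "distributed M lborel X f" and nonneg: "\<And>x. x \<in> space M \<Longrightarrow> 0 \<le> X x"
  shows "AE v in lborel. v \<le> 0 \<longrightarrow> f v = 0"
proof -
  note f = distributed_borel_measurable[OF X]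
  have "AE v in lborel. v \<in> {0} \<longrightarrow> f v = 0"
    using AE_lborel_singleton[of 0] by eventually_elim simp
  then have null: "{0} \<in> null_sets (density lborel f)"
    by (simp add: null_sets_density_iff[OF f])
  have "X -` {..0} \<inter> space M = X -` {0} \<inter> space M"
    using nonneg by (auto intro: antisym)
  then have "emeasure (density lborel f) {..0} = emeasure (density lborel f) {0}"
    using distributed_measurable[OF X]
    by (simp add: distributed_distr_eq_density[OF X, symmetric] emeasure_distr)
  with null have "{..0} \<in> null_sets (density lborel f)"
    by (simp add: null_sets_def)
  then show ?thesis
    by (simp add: null_sets_density_iff[OF f])
qed

text \<open>No positivity of measure N A is needed: if it vanishes, both sides are the null measure.\<close>

lemma distr_uniform_measure_eq_density:
  fixes X :: "'a \<Rightarrow> real" and g c :: "real \<Rightarrow> real"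
  assumes "finite_measure N" and X: "distributed N lborel X (\<lambda>v. ennreal (g v))"
    and g: "\<And>v. 0 \<le> g v" and A: "A \<in> sets N"
    and c: "integrable (distr N borel X) c"
    and disintegration:
      "\<And>B. B \<in> sets borel \<Longrightarrow> measure N {w \<in> A. X w \<in> B} = (\<integral>v\<in>B. c v \<partial>distr N borel X)"
  shows "distr (uniform_measure N A) lborel X = density lborel (\<lambda>v. ennreal (g v * c v / measure N A))"
proof -
  interpret finite_measure N by fact
  define p where "p = measure N A"
  have [measurable]: "X \<in> borel_measurable N"
    using distributed_measurable[OF X] by simp
  have [measurable]: "g \<in> borel_measurable borel"
    using distributed_borel_measurable[OF X] g by simp
  have "distr N borel X = distr N lborel X"
    by (rule distr_cong) auto
  then have law: "distr N borel X = density lborel (\<lambda>v. ennreal (g v))"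
    using distributed_distr_eq_density[OF X] by simp
  have c_meas [measurable]: "c \<in> borel_measurable borel"
    using borel_measurable_integrable[OF c] by simp
  have gc: "integrable lborel (\<lambda>v. g v * c v)"
    using c unfolding law by (subst (asm) integrable_density) (auto simp: g)
  have prob_eq: "measure N {w \<in> A. X w \<in> B} = (\<integral>v\<in>B. g v * c v \<partial>lborel)"
    if B [measurable]: "B \<in> sets borel" for B
  proof -
    have "(\<integral>v\<in>B. c v \<partial>distr N borel X) = (\<integral>v\<in>B. g v * c v \<partial>lborel)"
      unfolding law set_lebesgue_integral_def
      by (subst integral_density) (auto simp: g mult.left_commute)
    then show ?thesis
      using disintegration[OF B] by simp
  qed
  have "AE v in lborel. 0 \<le> g v * c v"
    using gc by (rule AE_nonneg_if_set_integral_nonneg) (simp add: prob_eq[symmetric])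
  show ?thesis
  proof (rule measure_eqI)
    fix B assume "B \<in> sets (distr (uniform_measure N A) lborel X)"
    then have B [measurable]: "B \<in> sets borel" by simp
    have "emeasure (density lborel (\<lambda>v. ennreal (g v * c v / p))) B
            = (\<integral>\<^sup>+ v. ennreal (indicator B v * (g v * c v) / p) \<partial>lborel)"
      by (subst emeasure_density) (auto intro!: nn_integral_cong simp: indicator_def)
    also have "\<dots> = ennreal ((\<integral>v\<in>B. g v * c v \<partial>lborel) / p)"
      using \<open>AE v in lborel. 0 \<le> g v * c v\<close> integrable_mult_indicator[OF _ gc, of B]
      by (subst nn_integral_eq_integral)
         (auto simp: set_lebesgue_integral_def p_def
               elim!: eventually_mono)
    also have "\<dots> = ennreal (measure N {w \<in> A. X w \<in> B} / p)"
      by (simp add: prob_eq)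
    also have "\<dots> = emeasure N {w \<in> A. X w \<in> B} / emeasure N A"
    proof (cases "p = 0")
      case True
      then have "measure N {w \<in> A. X w \<in> B} = 0"
        using finite_measure_mono[of "{w \<in> A. X w \<in> B}" A] A measure_nonneg[of N "{w \<in> A. X w \<in> B}"]
        unfolding p_def by simp
      then show ?thesis
        using True A by (simp add: emeasure_eq_measure p_def)
    next
      case False
      then have "0 < measure N A"
        using measure_nonneg[of N A] unfolding p_def by linarith
      then show ?thesis
        using A by (simp add: emeasure_eq_measure divide_ennreal p_def)
    qed
    also have "\<dots> = emeasure (distr (uniform_measure N A) lborel X) B"
    proof -
      have "X -` B \<inter> space N \<inter> A = {w \<in> A. X w \<in> B}"
        using sets.sets_into_space[OF A] by auto
      then show ?thesis
        using A by (simp add: emeasure_distr Int_commute)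
    qed
    finally show "emeasure (distr (uniform_measure N A) lborel X) B
                    = emeasure (density lborel (\<lambda>v. ennreal (g v * c v / measure N A))) B"
      by (simp add: p_def)
  qed simp
qed

lemma distributed_uniform_measure_nonneg:
  fixes X :: "'a \<Rightarrow> real" and g c :: "real \<Rightarrow> real"
  assumes N: "finite_measure N" and X: "distributed N lborel X (\<lambda>v. ennreal (g v))"
    and g: "\<And>v. 0 \<le> g v" and X_nonneg: "\<And>w. w \<in> space N \<Longrightarrow> 0 \<le> X w" and A: "A \<in> sets N"
    and c: "integrable (distr N borel X) c"
    and disintegration:
      "\<And>B. B \<in> sets borel \<Longrightarrow> measure N {w \<in> A. X w \<in> B} = (\<integral>v\<in>B. c v \<partial>distr N borel X)"
  shows "distributed (uniform_measure N A) lborel X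
           (\<lambda>v. ennreal (if v > 0 then g v * c v / measure N A else 0))"
proof -
  have [measurable]: "g \<in> borel_measurable borel" "c \<in> borel_measurable borel"
    using distributed_borel_measurable[OF X] g borel_measurable_integrable[OF c] by simp_all
  have "AE v in lborel. v \<le> 0 \<longrightarrow> ennreal (g v) = 0"
    using X X_nonneg by (rule distributed_nonneg_AE_density_eq_0)
  then have "density lborel (\<lambda>v. ennreal (g v * c v / measure N A))
               = density lborel (\<lambda>v. ennreal (if v > 0 then g v * c v / measure N A else 0))"
    by (intro density_cong) (auto elim!: eventually_mono simp: g)
  then show ?thesis
    using distr_uniform_measure_eq_density[OF N X g A c disintegration] distributed_measurable[OF X]
    unfolding distributed_def by (simp cong: measurable_cong_sets)
qed

theorem proposition8:
  fixes \<xi> :: "real^'d" and \<Omega> :: "real^'d^'d" and \<Delta> :: "real^'m^'d"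
    and \<tau> :: "real^'m" and \<Gamma> :: "real^'m^'m" and \<nu> :: real
    and M :: "'a measure" and Y :: "'a \<Rightarrow> real^'d"
    and N :: "'b measure" and U0s :: "'b \<Rightarrow> real^'m" and U1 :: "'b \<Rightarrow> real^'d"
    and g :: "real \<Rightarrow> real" and c :: "real \<Rightarrow> real"
  assumes \<Omega>_pd: "pos_def_mat \<Omega>"
    and \<Gamma>_corr: "corr_mat \<Gamma>"
    and star_pd: "pos_def_mat (block_mat \<Gamma> \<Delta> (corr_of \<Omega>))"
    and \<nu>_pos: "\<nu> > 0"
    and M: "prob_space M"
    and Y_meas: "Y \<in> borel_measurable M"
    and Y_law: "distr M borel Y = SUT \<xi> \<Omega> \<Delta> \<tau> \<Gamma> \<nu>"
    and N: "prob_space N"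
    and U0s_meas: "U0s \<in> borel_measurable N"
    and U1_meas: "U1 \<in> borel_measurable N"
    and U_law: "distr N borel (\<lambda>w. vjoin (U0s w) (U1 w)) =
                mvt_measure 0 (block_mat (\<Gamma> - transpose \<Delta> ** matrix_inv (corr_of \<Omega>) ** \<Delta>) 0
                                          (corr_of \<Omega>)) \<nu>"
    and g_nonneg: "\<forall>v. g v \<ge> 0"
    and g_density: "distributed N lborel
                      (\<lambda>w. U1 w \<bullet> (matrix_inv (corr_of \<Omega>) *v U1 w)) (\<lambda>v. ennreal (g v))"
    and c_meas: "c \<in> borel_measurable borel"
    and c_int: "integrable (distr N borel (\<lambda>w. U1 w \<bullet> (matrix_inv (corr_of \<Omega>) *v U1 w))) c"
    and c_cond: "\<forall>B \<in> sets borel.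
        measure N {w \<in> space N.
            (\<forall>i. U0s w $ i < ((transpose \<Delta> ** matrix_inv (corr_of \<Omega>)) *v U1 w + \<tau>) $ i)
            \<and> U1 w \<bullet> (matrix_inv (corr_of \<Omega>) *v U1 w) \<in> B}
        = (LINT v:B | distr N borel (\<lambda>w. U1 w \<bullet> (matrix_inv (corr_of \<Omega>) *v U1 w)). c v)"
  shows "distributed M lborel
           (\<lambda>w. (Y w - \<xi>) \<bullet> (matrix_inv \<Omega> *v (Y w - \<xi>)))
           (\<lambda>v. ennreal (if v > 0 then
                   g v * c v /
                   measure N {w \<in> space N.
                     \<forall>i. U0s w $ i < ((transpose \<Delta> ** matrix_inv (corr_of \<Omega>)) *v U1 w + \<tau>) $ i}
                 else 0))"
proof -
  define QU where "QU = (\<lambda>w. U1 w \<bullet> (matrix_inv (corr_of \<Omega>) *v U1 w))"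
  define Ev where "Ev = {w \<in> space N.
    \<forall>i. U0s w $ i < ((transpose \<Delta> ** matrix_inv (corr_of \<Omega>)) *v U1 w + \<tau>) $ i}"
  interpret N: prob_space N by (rule N)
  have "distr M lborel (\<lambda>w. (Y w - \<xi>) \<bullet> (matrix_inv \<Omega> *v (Y w - \<xi>)))
          = distr (SUT \<xi> \<Omega> \<Delta> \<tau> \<Gamma> \<nu>) borel (\<lambda>y. (y - \<xi>) \<bullet> (matrix_inv \<Omega> *v (y - \<xi>)))"
    unfolding Y_law[symmetric] using Y_meas by (subst distr_distr) (auto simp: comp_def intro!: distr_cong)
  also have "\<dots> = distr (uniform_measure N Ev) lborel QU"
    unfolding distr_SUT_quadratic_form[OF \<Omega>_pd star_pd U0s_meas U1_meas U_law] Ev_def QU_def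
    by (rule distr_cong) auto
  moreover have "distributed (uniform_measure N Ev) lborel QU
                   (\<lambda>v. ennreal (if v > 0 then g v * c v / measure N Ev else 0))"
  proof (rule distributed_uniform_measure_nonneg)
    show "Ev \<in> sets N"
      unfolding Ev_def using U0s_meas U1_meas by measurable
    show "0 \<le> QU w" for w
      using quadratic_form_matrix_inv_nonneg[OF pos_def_mat_block_mat_lower[OF star_pd]]
      by (simp add: QU_def)
    show "measure N {w \<in> Ev. QU w \<in> B} = (\<integral>v\<in>B. c v \<partial>distr N borel QU)" if "B \<in> sets borel" for B
      using c_cond that unfolding Ev_def QU_def by (auto cong: conj_cong)
  qed (use g_density c_int g_nonneg N.finite_measure_axioms in \<open>auto simp: QU_def\<close>)
  ultimately show ?thesis
    using Y_meas unfolding distributed_def Ev_def by simp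
qed

end
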